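(* Let $w,p,q$ be commuting indeterminates. Let the seed sequences be $s_0=wp$ and $$(s_\ell,t_\ell)=\left(([\ell]_{w,q}+p[\ell+1]_q)q^\ell,\; p[\ell]_{w,q}[\ell]_q q^{2\ell-1}\right)\qquad(\ell\ge 1).$$ Then for all $n,k\ge 0$ the entry $a_{n,k}$ of the associated Catalan matrix satisfies $$a_{n,k}=\sum_{\pi\in \mathfrak{P}_{n,k}}w^{\mathsf{rlmin}(\pi)}p^{\mathsf{wex}(\pi)}q^{\mathsf{inv}(\pi)}.$$
   Context: Catalan matrix: given seeds $\mathbf s=(s_0,s_1,\ldots)$ and $\mathbf t=(t_1,t_2,\ldots)$ with all $t_i\neq 0$, the (generalized) Catalan matrix $(a_{n,k})_{n,k\ge 0}$ is defined by $a_{0,0}=1$, $a_{0,k}=0$ for $k>0$, and $a_{n,k}=a_{n-1,k-1}+s_ka_{n-1,k}+t_{k+1}a_{n-1,k+1}$ for $n\ge1$, where $a_{n,-1}=0$. Partial permutations: a partial permutation of order $n$ is an $n\times n$ $(0,1)$-matrix $\pi=(\pi_{i,j})$ with at most one $1$ in each row and each column; $\mathfrak{P}_{n,k}$ is the set of those with exactly $k$ zero rows (for $n=0$ there is only the empty matrix, lying in $\mathfrak{P}_{0,0}$). Statistics: $\mathsf{inv}(\pi)$ is defined as follows: for each $1$ delete all entries to its right in its row and all entries below it in its column; $\mathsf{inv}(\pi)$ is the number of remaining $0$ entries that have a $1$ in their row or in their column (or both). $\mathsf{wex}(\pi)$ is the number of pairs $(i,j)$ with $\pi_{i,j}=1$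 and $i\le j$. $\mathsf{rlmin}(\pi)$ is the number of positions $(i,j)$ with $\pi_{i,j}=1$ such that for every column $1\le c<j$ there is a $1$ in column $c$ in some row $r<i$ (vacuous if $j=1$). $q$-notation: $[n]_q=1+q+\cdots+q^{n-1}$ and $[n]_{w,q}=w+q+\cdots+q^{n-1}$ for $n\ge1$ (so $[1]_{w,q}=w$), with $[0]_q=[0]_{w,q}=0$. *)

theory Defs
  imports
    "HOL-Computational_Algebra.Polynomial"
    "Jordan_Normal_Form.Matrix"
begin

text \<open>The seed \<open>t\<close> is indexed from 1; its value at 0 is never used.\<close>

fun catalan_matrix :: "(nat \<Rightarrow> 'a::comm_ring_1) \<Rightarrow> (nat \<Rightarrow> 'a) \<Rightarrow> nat \<Rightarrow> nat \<Rightarrow> 'a" where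
  "catalan_matrix s t 0 k = (if k = 0 then 1 else 0)"
| "catalan_matrix s t (Suc n) k =
     (if k = 0 then 0 else catalan_matrix s t n (k - 1))
     + s k * catalan_matrix s t n k
     + t (k + 1) * catalan_matrix s t n (k + 1)"

definition q_int :: "'a::comm_ring_1 \<Rightarrow> nat \<Rightarrow> 'a" where
  "q_int q n = (\<Sum>i<n. q ^ i)"

definition wq_int :: "'a::comm_ring_1 \<Rightarrow> 'a \<Rightarrow> nat \<Rightarrow> 'a" where
  "wq_int w q n = (if n = 0 then 0 else w + (\<Sum>i=1..<n. q ^ i))"

definition seed_s :: "'a::comm_ring_1 \<Rightarrow> 'a \<Rightarrow> 'a \<Rightarrow> nat \<Rightarrow> 'a" where
  "seed_s w p q l =
     (if l = 0 then w * p else (wq_int w q l + p * q_int q (l + 1)) * q ^ l)"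

definition seed_t :: "'a::comm_ring_1 \<Rightarrow> 'a \<Rightarrow> 'a \<Rightarrow> nat \<Rightarrow> 'a" where
  "seed_t w p q l = p * wq_int w q l * q_int q l * q ^ (2 * l - 1)"

text \<open>
  Rows and columns are indexed by \<open>0, ..., n - 1\<close> as usual for \<^typ>\<open>'a mat\<close>. All notions below
  only compare indices, so the shift from \<open>1, ..., n\<close> does not affect them.
\<close>

definition partial_perms :: "nat \<Rightarrow> nat \<Rightarrow> nat mat set" where
  "partial_perms n k = {A \<in> carrier_mat n n.
     (\<forall>i<n. \<forall>j<n. A $$ (i, j) \<in> {0, 1}) \<and>
     (\<forall>i<n. card {j. j < n \<and> A $$ (i, j) = 1} \<le> 1) \<and>
     (\<forall>j<n. card {i. i < n \<and> A $$ (i, j) = 1} \<le> 1) \<and>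
     card {i. i < n \<and> (\<forall>j<n. A $$ (i, j) = 0)} = k}"

definition deleted_entry :: "nat mat \<Rightarrow> nat \<Rightarrow> nat \<Rightarrow> bool" where
  "deleted_entry A i j \<longleftrightarrow> (\<exists>c<j. A $$ (i, c) = 1) \<or> (\<exists>r<i. A $$ (r, j) = 1)"

definition pp_inv :: "nat mat \<Rightarrow> nat" where
  "pp_inv A = card {(i, j). i < dim_row A \<and> j < dim_col A \<and>
     A $$ (i, j) = 0 \<and> \<not> deleted_entry A i j \<and>
     ((\<exists>c<dim_col A. A $$ (i, c) = 1) \<or> (\<exists>r<dim_row A. A $$ (r, j) = 1))}"

definition pp_wex :: "nat mat \<Rightarrow> nat" where
  "pp_wex A = card {(i, j). i < dim_row A \<and> j < dim_col A \<and> A $$ (i, j) = 1 \<and> i \<le> j}"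

definition pp_rlmin :: "nat mat \<Rightarrow> nat" where
  "pp_rlmin A = card {(i, j). i < dim_row A \<and> j < dim_col A \<and> A $$ (i, j) = 1 \<and>
     (\<forall>c<j. \<exists>r<i. A $$ (r, c) = 1)}"

text \<open>
  The polynomial ring \<open>\<int>[w, p, q]\<close> is built as \<open>\<int>[w][p][q]\<close>, with \<open>w\<close>, \<open>p\<close>, \<open>q\<close> the
  indeterminates of the innermost, middle and outermost layer.
\<close>

type_synonym wpq_poly = "int poly poly poly"

definition indet_w :: wpq_poly where "indet_w = [:[:[:0, 1:]:]:]"
definition indet_p :: wpq_poly where "indet_p = [:[:0, 1:]:]"
definition indet_q :: wpq_poly where "indet_q = [:0, 1:]"

text \<open>
  The seeds of a Catalan matrix are required to satisfy \<open>t\<^sub>l \<noteq> 0\<close> for \<open>l \<ge> 1\<close>. The recurrence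
  does not depend on this, so it is not built into \<open>catalan_matrix\<close>; it holds here.
\<close>

lemma poly0_q_int: "l \<ge> 1 \<Longrightarrow> poly (q_int indet_q l) 0 = 1"
  by (cases l) (simp_all add: q_int_def poly_sum indet_q_def sum.lessThan_Suc_shift del: sum.lessThan_Suc)

lemma poly0_wq_int: "l \<ge> 1 \<Longrightarrow> poly (wq_int indet_w indet_q l) 0 = [:[:0, 1:]:]"
  by (auto simp: wq_int_def poly_sum indet_q_def indet_w_def power_0_left intro!: sum.neutral)

lemma seed_t_nonzero:
  assumes "l \<ge> 1"
  shows "seed_t indet_w indet_p indet_q l \<noteq> 0"
proof -
  have "q_int indet_q l \<noteq> 0" "wq_int indet_w indet_q l \<noteq> 0"
    using poly0_q_int[OF assms] poly0_wq_int[OF assms] by auto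
  then show ?thesis
    by (simp add: seed_t_def indet_p_def indet_q_def)
qed

end

theory Submission
  imports Defs
begin

text \<open>
  Identify a partial permutation with the set of positions of its ones and build an
  \<open>(n + 1) \<times> (n + 1)\<close> placement from an \<open>n \<times> n\<close> one by appending first a row and then a column.
  Appending a zero line changes no statistic. A one placed in a new row at an empty column adds to
  \<open>inv\<close> the number of empty columns to its left plus the number of all empty rows; summing over
  the empty columns gives a \<open>q\<close>-integer, and only the leftmost empty column produces a right-to-left
  minimum, which turns it into a \<open>(w, q)\<close>-integer. Columns behave in the same way, except that every
  new one is a weak excedance and it is a right-to-left minimum only if the old placement is a full
  permutation and the new one sits in the corner. Multiplying the contributions of the two steps
  gives the recurrence of the Catalan matrix.
\<close>

section \<open>Placements and their statistics\<close>

text \<open>Boards are rectangular because the intermediate stage, after a row but before a column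
  is appended, has shape \<open>Suc n\<close> by \<open>n\<close>. The parameter \<open>e\<close>
  counts empty rows.\<close>

definition placements :: "nat \<Rightarrow> nat \<Rightarrow> nat \<Rightarrow> (nat \<times> nat) set set" where
  "placements m n e = {S. S \<subseteq> {..<m} \<times> {..<n} \<and> single_valued S \<and> single_valued (S\<inverse>) \<and>
     card ({..<m} - Domain S) = e}"

text \<open>No board size is needed: a one in the row or column but none at or before the cell means
  that some one lies further on, so the cell is on the board. The non-strict bounds also make the
  cell itself a zero.\<close>

definition inv_set :: "(nat \<times> nat) set \<Rightarrow> (nat \<times> nat) set" where
  "inv_set S = {(i, j). (\<forall>c\<le>j. (i, c) \<notin> S) \<and> (\<forall>r\<le>i. (r, j) \<notin> S) \<and>
     (i \<in> Domain S \<or> j \<in> Range S)}"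

definition wex_set :: "(nat \<times> nat) set \<Rightarrow> (nat \<times> nat) set" where
  "wex_set S = {(i, j) \<in> S. i \<le> j}"

definition rlmin_set :: "(nat \<times> nat) set \<Rightarrow> (nat \<times> nat) set" where
  "rlmin_set S = {(i, j) \<in> S. \<forall>c<j. \<exists>r<i. (r, c) \<in> S}"

definition weight :: "'a::comm_ring_1 \<Rightarrow> 'a \<Rightarrow> 'a \<Rightarrow> (nat \<times> nat) set \<Rightarrow> 'a" where
  "weight w p q S = w ^ card (rlmin_set S) * p ^ card (wex_set S) * q ^ card (inv_set S)"

lemma finite_placements [simp]: "finite (placements m n e)"
  by (rule finite_subset[of _ "Pow ({..<m} \<times> {..<n})"]) (auto simp: placements_def)

lemma card_Domain_eq_card:
  assumes "single_valued S"
  shows "card (Domain S) = card S"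
proof -
  have "inj_on fst S"
    using assms by (auto simp: inj_on_def single_valued_def)
  then show ?thesis
    by (simp add: Domain_fst card_image)
qed

lemma card_Range_eq_card:
  assumes "single_valued (S\<inverse>)"
  shows "card (Range S) = card S"
  using card_Domain_eq_card[OF assms] by simp

text \<open>Occupied rows and occupied columns are both equinumerous with \<open>S\<close>. The
  additive form avoids truncated subtraction.\<close>

lemma placements_card_empty_columns:
  assumes "S \<in> placements m n e"
  shows "card ({..<n} - Range S) + m = e + n"
proof -
  have S: "S \<subseteq> {..<m} \<times> {..<n}" "single_valued S" "single_valued (S\<inverse>)"
    and e: "card ({..<m} - Domain S) = e"
    using assms by (auto simp: placements_def)
  have D: "Domain S \<subseteq> {..<m}" and R: "Range S \<subseteq> {..<n}"
    using S(1) by auto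
  have "card ({..<m} - Domain S) = m - card S" "card S \<le> m"
    using card_Diff_subset[OF finite_subset[OF D] D] card_mono[OF _ D] card_Domain_eq_card[OF S(2)]
    by auto
  moreover have "card ({..<n} - Range S) = n - card S" "card S \<le> n"
    using card_Diff_subset[OF finite_subset[OF R] R] card_mono[OF _ R] card_Range_eq_card[OF S(3)]
    by auto
  ultimately show ?thesis
    using e by linarith
qed

section \<open>Inversions gained by adding a one in a new line\<close>

lemma inv_set_subset:
  assumes "S \<subseteq> {..<m} \<times> {..<n}"
  shows "inv_set S \<subseteq> {..<m} \<times> {..<n}"
proof clarify
  fix i j assume "(i, j) \<in> inv_set S"
  then have *: "\<forall>c\<le>j. (i, c) \<notin> S" "\<forall>r\<le>i. (r, j) \<notin> S" "i \<in> Domain S \<or> j \<in> Range S"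
    by (auto simp: inv_set_def)
  from *(3) show "i \<in> {..<m} \<and> j \<in> {..<n}"
  proof
    assume "i \<in> Domain S"
    then obtain c where c: "(i, c) \<in> S" by blast
    with *(1) have "j < c" by (meson not_le_imp_less)
    with c assms show ?thesis by auto
  next
    assume "j \<in> Range S"
    then obtain r where r: "(r, j) \<in> S" by blast
    with *(2) have "i < r" by (meson not_le_imp_less)
    with r assms show ?thesis by auto
  qed
qed

lemma inv_set_converse: "inv_set (S\<inverse>) = (inv_set S)\<inverse>"
  by (auto simp: inv_set_def)

text \<open>Old inversions survive, as the new one only deletes cells outside the old board. The
  gain is row \<open>i\<close> at the empty columns, and column \<open>n\<close> above row
  \<open>i\<close> at the empty rows. In row \<open>i\<close>, a cell of an occupied column is
  either below its one, hence deleted, or above it, hence already counted.\<close>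

lemma card_inv_set_insert_column:
  assumes S: "S \<subseteq> {..<m} \<times> {..<n}" and i: "i \<in> {..<m} - Domain S"
  shows "card (inv_set (insert (i, n) S)) =
    card (inv_set S) + card ({..<n} - Range S) + card {r \<in> {..<m} - Domain S. r < i}"
proof -
  let ?E = "{r \<in> {..<m} - Domain S. r < i}" and ?F = "{..<n} - Range S"
  have out: "(a, b) \<notin> S" if "n \<le> b" for a b
    using S that by auto
  have "inv_set (insert (i, n) S) = (inv_set S \<union> {i} \<times> ?F) \<union> ?E \<times> {n}" (is "?L = ?R")
  proof (intro equalityI subsetI)
    fix x assume x: "x \<in> ?L"
    obtain a b where [simp]: "x = (a, b)" by (cases x)
    have *: "\<forall>c\<le>b. (a, c) \<notin> S" "\<forall>r\<le>a. (r, b) \<notin> S" "\<not> (a = i \<and> n \<le> b)" "\<not> (i \<le> a \<and> b = n)"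
      "a \<in> Domain S \<or> a = i \<or> b \<in> Range S \<or> b = n"
      using x by (auto simp: inv_set_def)
    \<comment> \<open>If an old one shares the row or column of the cell, the cell was counted
      before; otherwise it owes its place to the new one, so \<open>a = i\<close> or
      \<open>b = n\<close>.\<close>
    show "x \<in> ?R"
    proof (cases "a \<in> Domain S \<or> b \<in> Range S")
      case True
      then show ?thesis using * by (auto simp: inv_set_def)
    next
      case False
      then show ?thesis using * i by auto
    qed
  next
    fix x assume x: "x \<in> ?R"
    obtain a b where [simp]: "x = (a, b)" by (cases x)
    from x consider "(a, b) \<in> inv_set S" | "a = i" "b < n" "b \<notin> Range S"
      | "a < i" "a \<notin> Domain S" "b = n" by auto
    then show "x \<in> ?L"
    proof cases
      case 1
      have "b < n" using inv_set_subset[OF S] 1 by auto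
      then show ?thesis using 1 by (auto simp: inv_set_def)
    next
      case 2
      then show ?thesis using i by (auto simp: inv_set_def)
    next
      case 3
      then show ?thesis using out by (auto simp: inv_set_def)
    qed
  qed
  moreover have "inv_set S \<inter> {i} \<times> ?F = {}"
    using i by (auto simp: inv_set_def)
  moreover have "(inv_set S \<union> {i} \<times> ?F) \<inter> ?E \<times> {n} = {}"
    using inv_set_subset[OF S] by auto
  moreover have "finite (inv_set S)"
    using inv_set_subset[OF S] finite_subset by blast
  ultimately show ?thesis
    by (simp add: card_Un_disjoint card_cartesian_product)
qed

text \<open>Transposition preserves inversions and exchanges rows with columns, which reduces this
  to the column case.\<close>

lemma card_inv_set_insert_row:
  assumes S: "S \<subseteq> {..<m} \<times> {..<n}" and j: "j \<in> {..<n} - Range S"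
  shows "card (inv_set (insert (m, j) S)) =
    card (inv_set S) + card ({..<m} - Domain S) + card {c \<in> {..<n} - Range S. c < j}"
proof -
  have c: "card (inv_set (T\<inverse>)) = card (inv_set T)" for T
    by (simp add: inv_set_converse)
  have "S\<inverse> \<subseteq> {..<n} \<times> {..<m}" using S by auto
  from card_inv_set_insert_column[OF this, of j] j
  have "card (inv_set (insert (j, m) (S\<inverse>))) =
    card (inv_set S) + card ({..<m} - Domain S) + card {c \<in> {..<n} - Range S. c < j}"
    by (simp add: c)
  moreover have "insert (j, m) (S\<inverse>) = (insert (m, j) S)\<inverse>" by auto
  ultimately show ?thesis by (simp only: c)
qed

section \<open>Effect of a new one on the whole weight\<close>

lemma weight_insert_column:
  fixes w p q :: "'a::comm_ring_1"
  assumes S: "S \<subseteq> {..<m} \<times> {..<n}" and m: "m \<le> Suc n" and i: "i \<in> {..<m} - Domain S"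
  shows "weight w p q (insert (i, n) S) =
    (if \<forall>c<n. \<exists>r<i. (r, c) \<in> S then w else 1) * p * q ^ card ({..<n} - Range S) *
      q ^ card {r \<in> {..<m} - Domain S. r < i} * weight w p q S"
proof -
  have fin: "finite S" using S finite_subset by blast
  have new: "(i, n) \<notin> S" using S by auto
  \<comment> \<open>From \<open>i < m\<close> and \<open>m \<le> Suc n\<close> it follows that
    \<open>i \<le> n\<close>, so the new one is always a weak excedance.\<close>
  have "wex_set (insert (i, n) S) = insert (i, n) (wex_set S)"
    using i m by (auto simp: wex_set_def)
  then have 1: "card (wex_set (insert (i, n) S)) = Suc (card (wex_set S))"
    using new finite_subset[OF _ fin, of "wex_set S"] by (simp add: wex_set_def subset_iff)
  \<comment> \<open>The minimum condition at column \<open>b\<close> inspects only columns left of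
    \<open>b \<le> n\<close>, hence never the new column: old ones keep their status.\<close>
  have "(\<forall>c<b. \<exists>r<a. (r, c) \<in> insert (i, n) S) \<longleftrightarrow> (\<forall>c<b. \<exists>r<a. (r, c) \<in> S)" if "b \<le> n" for a b
    using that by auto
  moreover have "b \<le> n" if "(a, b) \<in> S" for a b
    using that S by auto
  ultimately have "rlmin_set (insert (i, n) S) =
    (if \<forall>c<n. \<exists>r<i. (r, c) \<in> S then insert (i, n) (rlmin_set S) else rlmin_set S)"
    by (auto simp: rlmin_set_def simp del: insert_iff elim!: insertE)
  moreover have "finite (rlmin_set S)" "(i, n) \<notin> rlmin_set S"
    using fin new by (auto simp: rlmin_set_def intro: finite_subset)
  ultimately have 2: "card (rlmin_set (insert (i, n) S)) =
    (if \<forall>c<n. \<exists>r<i. (r, c) \<in> S then Suc (card (rlmin_set S)) else card (rlmin_set S))"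
    by simp
  show ?thesis
    unfolding weight_def 1 2 card_inv_set_insert_column[OF S i] if_distrib[of "\<lambda>k. w ^ k"]
    by (auto simp only: power_add power_Suc mult_1_left ac_simps split: if_split)
qed

text \<open>As \<open>j < n \<le> m\<close>, the new one lies strictly below the diagonal. It is a
  minimum exactly when no empty column lies to its left; its rank among the empty columns is then 0,
  and \<open>w\<close> takes the place of \<open>q ^ 0\<close>.\<close>

lemma weight_insert_row:
  fixes w p q :: "'a::comm_ring_1"
  assumes S: "S \<subseteq> {..<m} \<times> {..<n}" and n: "n \<le> m" and j: "j \<in> {..<n} - Range S"
  shows "weight w p q (insert (m, j) S) = q ^ card ({..<m} - Domain S) *
      (if card {c \<in> {..<n} - Range S. c < j} = 0 then w
       else q ^ card {c \<in> {..<n} - Range S. c < j}) * weight w p q S"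
proof -
  let ?C = "{c \<in> {..<n} - Range S. c < j}"
  have fin: "finite S" using S finite_subset by blast
  have new: "(m, j) \<notin> S" using S by auto
  have 1: "wex_set (insert (m, j) S) = wex_set S"
    using j n by (auto simp: wex_set_def)
  \<comment> \<open>All old ones lie above row \<open>m\<close>, so the minimum condition for the
    new one only asks which columns are occupied.\<close>
  have "(\<exists>r<m. (r, c) \<in> S) \<longleftrightarrow> c \<in> Range S" for c
    using S by auto
  moreover have "c < n" if "c < j" for c
    using j that by auto
  then have "(\<forall>c<j. c \<in> Range S) \<longleftrightarrow> ?C = {}"
    by blast
  ultimately have "(\<forall>c<j. \<exists>r<m. (r, c) \<in> S) \<longleftrightarrow> ?C = {}"
    by simp
  then have all: "(\<forall>c<j. \<exists>r<m. (r, c) \<in> S) \<longleftrightarrow> card ?C = 0"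
    by simp
  have "(\<forall>c<b. \<exists>r<a. (r, c) \<in> insert (m, j) S) \<longleftrightarrow> (\<forall>c<b. \<exists>r<a. (r, c) \<in> S)" if "a \<le> m" for a b
    using that by auto
  moreover have "a \<le> m" if "(a, b) \<in> S" for a b
    using that S by auto
  ultimately have "rlmin_set (insert (m, j) S) =
    (if \<forall>c<j. \<exists>r<m. (r, c) \<in> S then insert (m, j) (rlmin_set S) else rlmin_set S)"
    by (auto simp: rlmin_set_def simp del: insert_iff elim!: insertE)
  moreover have "finite (rlmin_set S)" "(m, j) \<notin> rlmin_set S"
    using fin new by (auto simp: rlmin_set_def intro: finite_subset)
  ultimately have 2: "card (rlmin_set (insert (m, j) S)) =
    (if card ?C = 0 then Suc (card (rlmin_set S)) else card (rlmin_set S))"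
    unfolding all by simp
  show ?thesis
    unfolding weight_def 1 2 card_inv_set_insert_row[OF S j]
    by (cases "card ?C = 0")
      (simp_all only: if_True if_False simp_thms power_add power_Suc power_0 add_0_right
        mult_1_left mult_1_right ac_simps)
qed

section \<open>Summing over the position of the new one\<close>

text \<open>Ranks within \<open>A\<close> run through each value below \<open>card A\<close> once.
  Adding a new maximum leaves the other ranks alone and contributes the rank
  \<open>card A\<close>.\<close>

lemma sum_rank:
  fixes A :: "'b::linorder set"
  assumes "finite A"
  shows "(\<Sum>x\<in>A. g (card {y \<in> A. y < x})) = (\<Sum>i<card A. g i)"
  using assms
proof (induction A rule: finite_linorder_max_induct)
  case (insert b A)
  have "{y \<in> insert b A. y < x} = {y \<in> A. y < x}" if "x \<in> A" for x
    using insert.hyps that by fastforce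
  moreover have "{y \<in> insert b A. y < b} = A"
    using insert.hyps by auto
  moreover have "b \<notin> A" using insert.hyps by auto
  ultimately show ?case
    using insert by (simp add: add.commute)
qed simp

text \<open>This is the summand by rank to which \<open>sum_rank\<close> applies for rows, with
  \<open>w\<close> at rank 0.\<close>

lemma wq_int_eq_sum: "wq_int w q n = (\<Sum>i<n. if i = 0 then w else q ^ i)"
proof (cases n)
  case (Suc k)
  have "(\<Sum>i=1..<Suc k. q ^ i) = (\<Sum>i<k. q ^ Suc i)"
    by (simp only: One_nat_def sum.shift_bounds_Suc_ivl lessThan_atLeast0)
  then show ?thesis
    unfolding Suc wq_int_def sum.lessThan_Suc_shift by simp
qed (simp add: wq_int_def)

text \<open>The hypothesis \<open>gap\<close> prevents every possible new one from being a minimum,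
  so no \<open>w\<close> appears and the ranks of the empty rows sum to a plain
  \<open>q\<close>-integer.\<close>

lemma sum_weight_insert_column:
  fixes w p q :: "'a::comm_ring_1"
  assumes S: "S \<subseteq> {..<m} \<times> {..<n}" and m: "m \<le> Suc n"
    and gap: "\<And>i. i \<in> {..<m} - Domain S \<Longrightarrow> \<exists>c<n. \<forall>r<i. (r, c) \<notin> S"
  shows "(\<Sum>i\<in>{..<m} - Domain S. weight w p q (insert (i, n) S)) =
    p * q ^ card ({..<n} - Range S) * q_int q (card ({..<m} - Domain S)) * weight w p q S"
proof -
  let ?E = "{..<m} - Domain S"
  have "(\<Sum>i\<in>?E. weight w p q (insert (i, n) S)) =
    (\<Sum>i\<in>?E. p * q ^ card ({..<n} - Range S) * weight w p q S * q ^ card {r \<in> ?E. r < i})"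
  proof (intro sum.cong refl)
    fix i assume i: "i \<in> ?E"
    from gap[OF i] have "\<not> (\<forall>c<n. \<exists>r<i. (r, c) \<in> S)" by blast
    then show "weight w p q (insert (i, n) S) =
      p * q ^ card ({..<n} - Range S) * weight w p q S * q ^ card {r \<in> ?E. r < i}"
      unfolding weight_insert_column[OF S m i] if_not_P[OF \<open>\<not> _\<close>] by (simp add: ac_simps)
  qed
  also have "\<dots> = p * q ^ card ({..<n} - Range S) * weight w p q S *
      (\<Sum>i\<in>?E. q ^ card {r \<in> ?E. r < i})"
    by (simp only: sum_distrib_left)
  also have "(\<Sum>i\<in>?E. q ^ card {r \<in> ?E. r < i}) = q_int q (card ?E)"
    unfolding q_int_def by (rule sum_rank) simp
  finally show ?thesis by (simp add: algebra_simps)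
qed

lemma sum_weight_insert_row:
  fixes w p q :: "'a::comm_ring_1"
  assumes S: "S \<subseteq> {..<m} \<times> {..<n}" and n: "n \<le> m"
  shows "(\<Sum>j\<in>{..<n} - Range S. weight w p q (insert (m, j) S)) =
    q ^ card ({..<m} - Domain S) * wq_int w q (card ({..<n} - Range S)) * weight w p q S"
proof -
  let ?F = "{..<n} - Range S" and ?g = "\<lambda>k. if k = 0 then w else q ^ k"
  have "(\<Sum>j\<in>?F. weight w p q (insert (m, j) S)) =
    (\<Sum>j\<in>?F. q ^ card ({..<m} - Domain S) * weight w p q S * ?g (card {c \<in> ?F. c < j}))"
    by (intro sum.cong refl) (subst weight_insert_row[OF S n], simp_all add: algebra_simps)
  also have "\<dots> = q ^ card ({..<m} - Domain S) * weight w p q S *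
      (\<Sum>j\<in>?F. ?g (card {c \<in> ?F. c < j}))"
    by (simp only: sum_distrib_left)
  also have "(\<Sum>j\<in>?F. ?g (card {c \<in> ?F. c < j})) = wq_int w q (card ?F)"
    unfolding wq_int_eq_sum by (rule sum_rank) simp
  finally show ?thesis by (simp add: algebra_simps)
qed

section \<open>Appending a row or a column\<close>

lemma card_Diff_Domain_Suc:
  assumes "S \<subseteq> {..<m} \<times> {..<n}"
  shows "card ({..<Suc m} - Domain S) = Suc (card ({..<m} - Domain S))"
proof -
  have "{..<Suc m} - Domain S = insert m ({..<m} - Domain S)"
    using assms by (auto simp: less_Suc_eq)
  then show ?thesis by simp
qed

lemma insert_column_in_placements:
  assumes "S \<in> placements m n (Suc e)" "i \<in> {..<m} - Domain S"
  shows "insert (i, n) S \<in> placements m (Suc n) e"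
proof -
  have S: "S \<subseteq> {..<m} \<times> {..<n}" "single_valued S" "single_valued (S\<inverse>)"
    "card ({..<m} - Domain S) = Suc e"
    using assms(1) by (auto simp: placements_def)
  have "{..<m} - Domain (insert (i, n) S) = ({..<m} - Domain S) - {i}" by auto
  then have "card ({..<m} - Domain (insert (i, n) S)) = e"
    using assms(2) S(4) by simp
  moreover have "n \<notin> Range S" using S(1) by auto
  ultimately show ?thesis
    using S(1-3) assms(2) by (auto simp: placements_def single_valued_def)
qed

text \<open>Split by whether the last column is empty. If it is not, deleting its one frees a row,
  which accounts for \<open>Suc e\<close>.\<close>

lemma sum_placements_Suc_column:
  fixes f :: "(nat \<times> nat) set \<Rightarrow> 'a::comm_monoid_add"
  shows "sum f (placements m (Suc n) e) = sum f (placements m n e) +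
    (\<Sum>S\<in>placements m n (Suc e). \<Sum>i\<in>{..<m} - Domain S. f (insert (i, n) S))"
proof -
  let ?P = "placements m (Suc n) e"
  let ?I = "SIGMA S:placements m n (Suc e). {..<m} - Domain S"
  have old: "{S \<in> ?P. n \<notin> Range S} = placements m n e"
    unfolding placements_def by (force simp: less_Suc_eq)
  have new: "bij_betw (\<lambda>(S, i). insert (i, n) S) ?I {S \<in> ?P. n \<in> Range S}"
  proof (rule bij_betw_imageI)
    have *: "n \<notin> Range S" if "S \<in> placements m n (Suc e)" for S
      using that by (auto simp: placements_def)
    have eq: "S = T \<and> i = k"
      if a: "S \<in> placements m n (Suc e)" "T \<in> placements m n (Suc e)" "insert (i, n) S = insert (k, n) T"
      for S T i k
    proof -
      have "(i, n) \<in> insert (k, n) T" using a(3) by (metis insertI1)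
      then have "i = k" using *[OF a(2)] by auto
      moreover have "(i, n) \<notin> S" "(i, n) \<notin> T" using *[OF a(1)] *[OF a(2)] by auto
      ultimately have "S = T" using a(3) by (metis insert_ident)
      with \<open>i = k\<close> show ?thesis by blast
    qed
    show "inj_on (\<lambda>(S, i). insert (i, n) S) ?I"
    proof (rule inj_onI)
      fix x y assume "x \<in> ?I" "y \<in> ?I" "(case x of (S, i) \<Rightarrow> insert (i, n) S) = (case y of (S, i) \<Rightarrow> insert (i, n) S)"
      then show "x = y"
        using eq[of "fst x" "fst y" "snd x" "snd y"] by (cases x, cases y) simp
    qed
    show "(\<lambda>(S, i). insert (i, n) S) ` ?I = {S \<in> ?P. n \<in> Range S}"
    proof (intro equalityI subsetI)
      fix T assume "T \<in> (\<lambda>(S, i). insert (i, n) S) ` ?I"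
      then show "T \<in> {S \<in> ?P. n \<in> Range S}"
        using insert_column_in_placements by fastforce
    next
      fix T assume T: "T \<in> {S \<in> ?P. n \<in> Range S}"
      then obtain i where i: "(i, n) \<in> T" by auto
      have TP: "T \<subseteq> {..<m} \<times> {..<Suc n}" "single_valued T" "single_valued (T\<inverse>)"
        "card ({..<m} - Domain T) = e"
        using T by (auto simp: placements_def)
      \<comment> \<open>Single-valuedness of \<open>T\<close> and of its converse makes
        \<open>(i, n)\<close> the only one in row \<open>i\<close> and in column \<open>n\<close>,
        so its removal empties both.\<close>
      let ?S = "T - {(i, n)}"
      have iD: "i \<in> {..<m} - Domain ?S"
        using i TP(1,2) by (auto simp: single_valued_def)
      have "{..<m} - Domain ?S = insert i ({..<m} - Domain T)"
        using iD by auto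
      moreover have "i \<notin> {..<m} - Domain T" using i by auto
      ultimately have "card ({..<m} - Domain ?S) = Suc e" using TP(4) by simp
      moreover have "?S \<subseteq> {..<m} \<times> {..<n}"
      proof (rule subrelI)
        fix a b assume ab: "(a, b) \<in> ?S"
        then have "b \<noteq> n" using i TP(3) by (auto simp: single_valued_def)
        then show "(a, b) \<in> {..<m} \<times> {..<n}" using ab TP(1) by auto
      qed
      ultimately have "?S \<in> placements m n (Suc e)"
        using TP(2,3) by (auto simp: placements_def single_valued_def)
      moreover have "T = insert (i, n) ?S" using i by auto
      ultimately show "T \<in> (\<lambda>(S, i). insert (i, n) S) ` ?I"
        using iD by (intro image_eqI[of _ _ "(?S, i)"]) auto
    qed
  qed
  have "sum f ?P = sum f {S \<in> ?P. n \<notin> Range S} + sum f {S \<in> ?P. n \<in> Range S}"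
    by (subst sum.union_disjoint[symmetric]) (auto intro!: sum.cong)
  also have "sum f {S \<in> ?P. n \<in> Range S} = (\<Sum>(S, i)\<in>?I. f (insert (i, n) S))"
    using sum.reindex_bij_betw[OF new, of f, symmetric] by (simp add: case_prod_unfold)
  also have "\<dots> = (\<Sum>S\<in>placements m n (Suc e). \<Sum>i\<in>{..<m} - Domain S. f (insert (i, n) S))"
    by (rule sum.Sigma[symmetric]) auto
  finally show ?thesis unfolding old .
qed

lemma insert_row_in_placements:
  assumes "S \<in> placements m n e" "j \<in> {..<n} - Range S"
  shows "insert (m, j) S \<in> placements (Suc m) n e"
proof -
  have S: "S \<subseteq> {..<m} \<times> {..<n}" "single_valued S" "single_valued (S\<inverse>)"
    "card ({..<m} - Domain S) = e"
    using assms(1) by (auto simp: placements_def)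
  have "{..<Suc m} - Domain (insert (m, j) S) = {..<m} - Domain S" by auto
  moreover have "m \<notin> Domain S" using S(1) by auto
  ultimately show ?thesis
    using S assms(2) by (auto simp: placements_def single_valued_def)
qed

text \<open>Split by whether the last row is empty. If it is, it is itself one of the
  \<open>e\<close> empty rows, so \<open>e = 0\<close> is impossible and \<open>e - 1\<close>
  remain. If it is not, removing it leaves the number of empty rows unchanged.\<close>

lemma sum_placements_Suc_row:
  fixes f :: "(nat \<times> nat) set \<Rightarrow> 'a::comm_monoid_add"
  shows "sum f (placements (Suc m) n e) =
    (if e = 0 then 0 else sum f (placements m n (e - 1))) +
    (\<Sum>S\<in>placements m n e. \<Sum>j\<in>{..<n} - Range S. f (insert (m, j) S))"
proof -
  let ?P = "placements (Suc m) n e"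
  let ?I = "SIGMA S:placements m n e. {..<n} - Range S"
  have "S \<in> ?P \<and> m \<notin> Domain S \<longleftrightarrow> e \<noteq> 0 \<and> S \<in> placements m n (e - 1)" for S
  proof (cases "S \<subseteq> {..<m} \<times> {..<n}")
    case True
    then have "S \<subseteq> {..<Suc m} \<times> {..<n}" "m \<notin> Domain S" by auto
    with True card_Diff_Domain_Suc[OF True] show ?thesis
      by (auto simp: placements_def)
  next
    case False
    then have "m \<in> Domain S" if "S \<subseteq> {..<Suc m} \<times> {..<n}"
      using that by (force simp: less_Suc_eq)
    with False show ?thesis by (auto simp: placements_def)
  qed
  then have old: "{S \<in> ?P. m \<notin> Domain S} = (if e = 0 then {} else placements m n (e - 1))"
    by auto
  have new: "bij_betw (\<lambda>(S, j). insert (m, j) S) ?I {S \<in> ?P. m \<in> Domain S}"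
  proof (rule bij_betw_imageI)
    have *: "m \<notin> Domain S" if "S \<in> placements m n e" for S
      using that by (auto simp: placements_def)
    have eq: "S = T \<and> j = k"
      if a: "S \<in> placements m n e" "T \<in> placements m n e" "insert (m, j) S = insert (m, k) T"
      for S T j k
    proof -
      have "(m, j) \<in> insert (m, k) T" using a(3) by (metis insertI1)
      then have "j = k" using *[OF a(2)] by auto
      moreover have "(m, j) \<notin> S" "(m, j) \<notin> T" using *[OF a(1)] *[OF a(2)] by auto
      ultimately have "S = T" using a(3) by (metis insert_ident)
      with \<open>j = k\<close> show ?thesis by blast
    qed
    show "inj_on (\<lambda>(S, j). insert (m, j) S) ?I"
    proof (rule inj_onI)
      fix x y assume "x \<in> ?I" "y \<in> ?I" "(case x of (S, j) \<Rightarrow> insert (m, j) S) = (case y of (S, j) \<Rightarrow> insert (m, j) S)"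
      then show "x = y"
        using eq[of "fst x" "fst y" "snd x" "snd y"] by (cases x, cases y) simp
    qed
    show "(\<lambda>(S, j). insert (m, j) S) ` ?I = {S \<in> ?P. m \<in> Domain S}"
    proof (intro equalityI subsetI)
      fix T assume "T \<in> (\<lambda>(S, j). insert (m, j) S) ` ?I"
      then show "T \<in> {S \<in> ?P. m \<in> Domain S}"
        using insert_row_in_placements by fastforce
    next
      fix T assume T: "T \<in> {S \<in> ?P. m \<in> Domain S}"
      then obtain j where j: "(m, j) \<in> T" by auto
      have TP: "T \<subseteq> {..<Suc m} \<times> {..<n}" "single_valued T" "single_valued (T\<inverse>)"
        "card ({..<Suc m} - Domain T) = e"
        using T by (auto simp: placements_def)
      let ?S = "T - {(m, j)}"
      have jR: "j \<in> {..<n} - Range ?S"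
        using j TP(1,3) by (auto simp: single_valued_def)
      have "{..<m} - Domain ?S = {..<Suc m} - Domain T"
        using j by (auto simp: less_Suc_eq)
      then have "card ({..<m} - Domain ?S) = e" using TP(4) by simp
      moreover have "?S \<subseteq> {..<m} \<times> {..<n}"
      proof (rule subrelI)
        fix a b assume ab: "(a, b) \<in> ?S"
        then have "a \<noteq> m" using j TP(2) by (auto simp: single_valued_def)
        then show "(a, b) \<in> {..<m} \<times> {..<n}" using ab TP(1) by auto
      qed
      ultimately have "?S \<in> placements m n e"
        using TP(2,3) by (auto simp: placements_def single_valued_def)
      moreover have "T = insert (m, j) ?S" using j by auto
      ultimately show "T \<in> (\<lambda>(S, j). insert (m, j) S) ` ?I"
        using jR by (intro image_eqI[of _ _ "(?S, j)"]) auto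
    qed
  qed
  have "sum f ?P = sum f {S \<in> ?P. m \<notin> Domain S} + sum f {S \<in> ?P. m \<in> Domain S}"
    by (subst sum.union_disjoint[symmetric]) (auto intro!: sum.cong)
  also have "sum f {S \<in> ?P. m \<in> Domain S} = (\<Sum>(S, j)\<in>?I. f (insert (m, j) S))"
    using sum.reindex_bij_betw[OF new, of f, symmetric] by (simp add: case_prod_unfold)
  also have "\<dots> = (\<Sum>S\<in>placements m n e. \<Sum>j\<in>{..<n} - Range S. f (insert (m, j) S))"
    by (rule sum.Sigma[symmetric]) auto
  finally show ?thesis unfolding old by simp
qed

section \<open>The recurrence\<close>

lemma placements_square_cards:
  assumes "S \<in> placements n n k"
  shows "S \<subseteq> {..<n} \<times> {..<n}" "card ({..<n} - Domain S) = k" "card ({..<n} - Range S) = k"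
  using assms placements_card_empty_columns[OF assms] by (auto simp: placements_def)

text \<open>Here the appended row is zero and joins the \<open>k\<close> empty rows, giving
  \<open>q_int q (Suc k)\<close>. For \<open>k = 0\<close> the corner is the only choice, and all
  earlier columns have a one above it, so it is a minimum.\<close>

lemma sum_weight_corner_column:
  fixes w p q :: "'a::comm_ring_1"
  assumes S: "S \<in> placements n n k"
  shows "(\<Sum>i\<in>{..<Suc n} - Domain S. weight w p q (insert (i, n) S)) =
    (if k = 0 then w * p else p * q_int q (Suc k) * q ^ k) * weight w p q S"
proof -
  note c = placements_square_cards[OF S]
  have sub: "S \<subseteq> {..<Suc n} \<times> {..<n}" using c(1) by auto
  show ?thesis
  proof (cases "k = 0")
    case True
    have D: "{..<n} \<subseteq> Domain S" and R: "{..<n} \<subseteq> Range S" using c(2,3) True by auto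
    have E: "{..<Suc n} - Domain S = {n}" using D c(1) by (auto simp: less_Suc_eq)
    have full: "\<forall>c<n. \<exists>r<n. (r, c) \<in> S" using R c(1) by fastforce
    have n: "n \<in> {..<Suc n} - Domain S" "{r \<in> {n}. r < n} = {}" using E by auto
    have "weight w p q (insert (n, n) S) = w * p * weight w p q S"
      unfolding weight_insert_column[OF sub order_refl n(1)] c(3) E n(2) using full True by simp
    then show ?thesis using True E by simp
  next
    case False
    then have "{..<n} - Range S \<noteq> {}" using c(3) by (metis card.empty)
    \<comment> \<open>An empty column of \<open>S\<close> serves as the gap for every row.\<close>
    then have gap: "\<exists>c<n. \<forall>r<i. (r, c) \<notin> S" for i by auto
    show ?thesis
      using sum_weight_insert_column[OF sub order_refl gap, of w p q] c card_Diff_Domain_Suc[OF c(1)]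
        False by (simp add: algebra_simps)
  qed
qed

text \<open>The new row is occupied, so \<open>Suc k\<close> empty rows remain, but column
  \<open>j\<close> is used up, leaving \<open>k\<close> empty columns.\<close>

lemma sum_weight_row_then_column:
  fixes w p q :: "'a::comm_ring_1"
  assumes S: "S \<in> placements n n (Suc k)" and j: "j \<in> {..<n} - Range S"
  shows "(\<Sum>i\<in>{..<Suc n} - Domain (insert (n, j) S). weight w p q (insert (i, n) (insert (n, j) S))) =
    p * q ^ k * q_int q (Suc k) * weight w p q (insert (n, j) S)"
proof -
  have T: "insert (n, j) S \<in> placements (Suc n) n (Suc k)"
    by (rule insert_row_in_placements[OF S j])
  then have sub: "insert (n, j) S \<subseteq> {..<Suc n} \<times> {..<n}"
    and e: "card ({..<Suc n} - Domain (insert (n, j) S)) = Suc k"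
    by (simp_all add: placements_def)
  have f: "card ({..<n} - Range (insert (n, j) S)) = k"
    using placements_card_empty_columns[OF T] by simp
  \<comment> \<open>Column \<open>j\<close> has its only one in the bottom row \<open>n\<close>,
    which is never above row \<open>i \<le> n\<close>; hence it is a gap.\<close>
  have "\<exists>c<n. \<forall>r<i. (r, c) \<notin> insert (n, j) S"
    if "i \<in> {..<Suc n} - Domain (insert (n, j) S)" for i
    using that j by (intro exI[of _ j]) auto
  from sum_weight_insert_column[OF sub order_refl this, of w p q] show ?thesis
    unfolding e f .
qed

text \<open>Four cases, by whether the new row and the new column receive a one. Neither gives
  \<open>a n (k - 1)\<close>, exactly one gives the two summands of \<open>seed_s\<close>, and both
  give \<open>seed_t\<close>.\<close>

lemma sum_weight_placements_Suc:
  fixes w p q :: "'a::comm_ring_1"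
  defines "a \<equiv> \<lambda>n k. sum (weight w p q) (placements n n k)"
  shows "a (Suc n) k = (if k = 0 then 0 else a n (k - 1)) + seed_s w p q k * a n k +
    seed_t w p q (k + 1) * a n (k + 1)"
proof -
  let ?W = "weight w p q"
  let ?C = "\<lambda>S. \<Sum>i\<in>{..<Suc n} - Domain S. ?W (insert (i, n) S)"
  let ?D = "if k = 0 then w * p else p * q_int q (Suc k) * q ^ k"
  have row: "(\<Sum>S\<in>placements n n l. \<Sum>j\<in>{..<n} - Range S. ?W (insert (n, j) S)) =
    q ^ l * wq_int w q l * a n l" for l
    unfolding a_def sum_distrib_left
    by (intro sum.cong refl)
      (subst sum_weight_insert_row, auto simp: placements_square_cards)
  have "(\<Sum>S\<in>placements n n (Suc k). \<Sum>j\<in>{..<n} - Range S. ?C (insert (n, j) S)) =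
    (\<Sum>S\<in>placements n n (Suc k). \<Sum>j\<in>{..<n} - Range S.
      p * q ^ k * q_int q (Suc k) * ?W (insert (n, j) S))"
    by (intro sum.cong refl sum_weight_row_then_column)
  also have "\<dots> = p * q ^ k * q_int q (Suc k) * (q ^ Suc k * wq_int w q (Suc k) * a n (Suc k))"
    by (simp only: sum_distrib_left[symmetric] row)
  \<comment> \<open>The row contributes \<open>q ^ Suc k\<close> and the column
    \<open>q ^ k\<close>, which makes the exponent \<open>2 * (k + 1) - 1\<close>.\<close>
  also have "\<dots> = seed_t w p q (k + 1) * a n (k + 1)"
    by (simp add: seed_t_def mult_2_right power_add algebra_simps)
  finally have both: "(\<Sum>S\<in>placements n n (Suc k). \<Sum>j\<in>{..<n} - Range S. ?C (insert (n, j) S)) =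
    seed_t w p q (k + 1) * a n (k + 1)" .
  have col: "(\<Sum>S\<in>placements n n k. ?C S) = ?D * a n k"
    unfolding a_def sum_distrib_left by (intro sum.cong refl sum_weight_corner_column)
  have "a (Suc n) k = sum ?W (placements (Suc n) n k) + sum ?C (placements (Suc n) n (Suc k))"
    unfolding a_def by (rule sum_placements_Suc_column)
  also have "sum ?W (placements (Suc n) n k) =
    (if k = 0 then 0 else a n (k - 1)) + q ^ k * wq_int w q k * a n k"
    unfolding sum_placements_Suc_row row by (simp add: a_def)
  \<comment> \<open>With a one in the column, splitting on the row needs \<open>Suc k\<close> empty
    rows beforehand: a zero row comes from \<open>k\<close>, an occupied one from
    \<open>Suc k\<close>.\<close>
  also have "sum ?C (placements (Suc n) n (Suc k)) = ?D * a n k + seed_t w p q (k + 1) * a n (k + 1)"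
    unfolding sum_placements_Suc_row[of ?C] both using col by simp
  also have "(if k = 0 then 0 else a n (k - 1)) + q ^ k * wq_int w q k * a n k +
      (?D * a n k + seed_t w p q (k + 1) * a n (k + 1)) =
    (if k = 0 then 0 else a n (k - 1)) + seed_s w p q k * a n k +
      seed_t w p q (k + 1) * a n (k + 1)"
    \<comment> \<open>At \<open>k = 0\<close> the row part vanishes since
      \<open>wq_int w q 0 = 0\<close>, leaving the exceptional seed \<open>w * p\<close>.\<close>
    by (cases "k = 0") (simp_all add: seed_s_def wq_int_def[of _ _ 0] algebra_simps)
  finally show ?thesis .
qed

lemma catalan_matrix_eq_sum_weight:
  "catalan_matrix (seed_s w p q) (seed_t w p q) n k = sum (weight w p q) (placements n n k)"
proof (induction n arbitrary: k)
  case 0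
  have "placements 0 0 k = (if k = 0 then {{}} else {})"
    by (auto simp: placements_def)
  then show ?case
    by (simp add: weight_def inv_set_def wex_set_def rlmin_set_def)
next
  case (Suc n)
  show ?case
    unfolding catalan_matrix.simps Suc.IH sum_weight_placements_Suc ..
qed

section \<open>Partial permutation matrices as placements\<close>

definition ones :: "nat mat \<Rightarrow> (nat \<times> nat) set" where
  "ones A = {(i, j). i < dim_row A \<and> j < dim_col A \<and> A $$ (i, j) = 1}"

lemma card_le_1_iff:
  assumes "finite A"
  shows "card A \<le> 1 \<longleftrightarrow> (\<forall>x\<in>A. \<forall>y\<in>A. x = y)"
  using card_le_Suc0_iff_eq[OF assms] by simp

text \<open>The hypothesis \<open>bin\<close> turns rows without a 1 into zero rows; the bounds on
  rows and columns are single-valuedness of \<open>ones A\<close> and of its converse.\<close>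

lemma partial_perms_iff_placements:
  assumes A: "A \<in> carrier_mat n n" and bin: "\<forall>i<n. \<forall>j<n. A $$ (i, j) \<in> {0, 1}"
  shows "A \<in> partial_perms n k \<longleftrightarrow> ones A \<in> placements n n k"
proof -
  have d: "dim_row A = n" "dim_col A = n" using A by auto
  have "{i. i < n \<and> (\<forall>j<n. A $$ (i, j) = 0)} = {..<n} - Domain (ones A)"
    using bin d by (fastforce simp: ones_def)
  moreover have "ones A \<subseteq> {..<n} \<times> {..<n}" using d by (auto simp: ones_def)
  moreover have "(\<forall>i<n. card {j. j < n \<and> A $$ (i, j) = 1} \<le> 1) \<longleftrightarrow> single_valued (ones A)"
    unfolding single_valued_def by (subst card_le_1_iff) (auto simp: ones_def d)
  moreover have "(\<forall>j<n. card {i. i < n \<and> A $$ (i, j) = 1} \<le> 1) \<longleftrightarrow> single_valued ((ones A)\<inverse>)"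
    unfolding single_valued_def by (subst card_le_1_iff) (auto simp: ones_def d)
  ultimately show ?thesis
    using A bin by (simp add: partial_perms_def placements_def)
qed

lemma bij_betw_ones: "bij_betw ones (partial_perms n k) (placements n n k)"
proof (rule bij_betwI[where g = "\<lambda>S. mat n n (\<lambda>x. if x \<in> S then 1 else 0)"])
  let ?g = "\<lambda>S. mat n n (\<lambda>x. if x \<in> S then 1 else 0) :: nat mat"
  have g: "ones (?g S) = S" if "S \<in> placements n n k" for S
    using that by (auto simp: ones_def placements_def split: if_splits)
  then show "ones (?g S) = S" if "S \<in> placements n n k" for S
    using that .
  show "ones \<in> partial_perms n k \<rightarrow> placements n n k"
    using partial_perms_iff_placements by (auto simp: partial_perms_def)
  show "?g \<in> placements n n k \<rightarrow> partial_perms n k"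
    by (intro Pi_I) (subst partial_perms_iff_placements, auto simp: g)
  show "?g (ones A) = A" if "A \<in> partial_perms n k" for A
    using that by (intro eq_matI) (fastforce simp: partial_perms_def ones_def)+
qed

lemma stats_eq_weight:
  assumes "A \<in> partial_perms n k"
  shows "w ^ pp_rlmin A * p ^ pp_wex A * q ^ pp_inv A = weight w p q (ones A)"
proof -
  have d: "dim_row A = n" "dim_col A = n"
    using assms by (auto simp: partial_perms_def)
  have bin: "A $$ (i, j) = 0 \<longleftrightarrow> (i, j) \<notin> ones A" if "i < n" "j < n" for i j
  proof -
    have "A $$ (i, j) \<in> {0, 1}" using assms that by (simp add: partial_perms_def)
    then show ?thesis using that by (auto simp: ones_def d)
  qed
  have sub: "ones A \<subseteq> {..<n} \<times> {..<n}"
    by (auto simp: ones_def d)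
  \<comment> \<open>The unbounded-looking \<open>r\<close> and \<open>c\<close> stay on the board
    because \<open>r < i < n\<close> and \<open>c < j < n\<close>.\<close>
  have "{(i, j). i < n \<and> j < n \<and> A $$ (i, j) = 1 \<and> (\<forall>c<j. \<exists>r<i. A $$ (r, c) = 1)} =
    rlmin_set (ones A)"
    by (fastforce simp: rlmin_set_def ones_def d)
  then have 1: "pp_rlmin A = card (rlmin_set (ones A))"
    by (simp add: pp_rlmin_def d)
  have 2: "pp_wex A = card (wex_set (ones A))"
    unfolding pp_wex_def wex_set_def by (rule arg_cong[of _ _ card]) (auto simp: ones_def)
  have "i < n \<and> j < n \<and> A $$ (i, j) = 0 \<and> \<not> deleted_entry A i j \<and>
      ((\<exists>c<n. A $$ (i, c) = 1) \<or> (\<exists>r<n. A $$ (r, j) = 1)) \<longleftrightarrow> (i, j) \<in> inv_set (ones A)" for i j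
  proof (cases "i < n \<and> j < n")
    case True
    \<comment> \<open>Separating \<open>c = j\<close> from \<open>c < j\<close> splits the condition
      into a zero entry and the absence of deletion along the row.\<close>
    have "(\<forall>c\<le>j. (i, c) \<notin> ones A) \<longleftrightarrow> (i, j) \<notin> ones A \<and> (\<forall>c<j. A $$ (i, c) \<noteq> 1)"
      using True by (auto simp: ones_def d le_less)
    moreover have "(\<forall>r\<le>i. (r, j) \<notin> ones A) \<longleftrightarrow> (i, j) \<notin> ones A \<and> (\<forall>r<i. A $$ (r, j) \<noteq> 1)"
      using True by (auto simp: ones_def d le_less)
    moreover have "i \<in> Domain (ones A) \<longleftrightarrow> (\<exists>c<n. A $$ (i, c) = 1)"
      "j \<in> Range (ones A) \<longleftrightarrow> (\<exists>r<n. A $$ (r, j) = 1)"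
      using True by (auto simp: ones_def d)
    ultimately show ?thesis
      using True bin[of i j] by (auto simp: inv_set_def deleted_entry_def)
  next
    case False
    then show ?thesis using inv_set_subset[OF sub] by auto
  qed
  then have 3: "pp_inv A = card (inv_set (ones A))"
    by (simp add: pp_inv_def d)
  show ?thesis
    unfolding weight_def 1 2 3 ..
qed

theorem theorem3p1:
  fixes n k :: nat
  shows "catalan_matrix (seed_s indet_w indet_p indet_q) (seed_t indet_w indet_p indet_q) n k =
    (\<Sum>A\<in>partial_perms n k. indet_w ^ pp_rlmin A * indet_p ^ pp_wex A * indet_q ^ pp_inv A)"
  \<comment> \<open>The weight identity holds in every commutative ring; it is specialised to the
    indeterminates and reindexed along \<open>ones\<close>.\<close>
  by (simp add: catalan_matrix_eq_sum_weight stats_eq_weight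
      sum.reindex_bij_betw[OF bij_betw_ones, symmetric])

end
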